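(* Let $f$ be a complex-valued arithmetic function and assume there exists $0<\alpha<2$ such that $$\sum_{n \leqslant x} |f(n)|^2 \ll x^{\alpha} \quad (x \geqslant 1).$$ Then, for all sufficiently large real $x$, $$\sum_{n \leqslant x} f\left(\left\lfloor x/n \right\rfloor\right) = x \sum_{n=1}^{\infty} \frac{f(n)}{n(n+1)} + O\left( x^{(\alpha +1)/3} (\log x)^{(1+\alpha)(2+\varepsilon_2(x))/6} \right),$$ where $$\varepsilon_2(x) = \sqrt{\frac{2 \log \log \log x}{\log \log x}} \left( 1 + \frac{30}{\log \log \log x} \right).$$
   Context: $\lfloor \cdot\rfloor$ denotes the integer part. *)

theory Defs
  imports Complex_Main "HOL-Library.Landau_Symbols"
begin

definition eps2 :: "real \<Rightarrow> real" where
  "eps2 x = sqrt (2 * ln (ln (ln x)) / ln (ln x)) * (1 + 30 / ln (ln (ln x)))"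

end

theory Submission
  imports Defs "HOL-Analysis.L2_Norm"
begin

text \<open>
  Grouping the \<open>n\<close> by the value \<open>d = \<lfloor>x/n\<rfloor>\<close>, a value \<open>d\<close> is taken \<open>x/(d(d+1)) + O(1)\<close> times. For
  \<open>d \<le> x\<^bsup>2/3\<^esup>\<close> the \<open>O(1)\<close> errors contribute, by Cauchy--Schwarz, \<open>O(x\<^bsup>(\<alpha>+1)/3\<^esup>)\<close>. Larger \<open>d\<close> come
  from \<open>n < x\<^bsup>1/3\<^esup>\<close>; for these, and for the tail of the series, the pointwise bound
  \<open>f(d) = O(d\<^bsup>\<alpha>/2\<^esup>)\<close> suffices. So no power of the logarithm is needed: the logarithmic factor is
  eventually at least 1.
\<close>

section \<open>Power sums and tails by comparison with telescoping differences\<close>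

lemma powr_mvt:
  fixes a b p :: real
  assumes "0 < a" "a < b"
  obtains z where "a < z" "z < b" "b powr p - a powr p = (b - a) * (p * z powr (p - 1))"
proof -
  have "\<exists>z>a. z < b \<and> b powr p - a powr p = (b - a) * (p * z powr (p - 1))"
    by (rule MVT2) (use assms in \<open>auto intro!: derivative_eq_intros\<close>)
  with that show thesis by blast
qed

text \<open>The mean value point lies below a + 1, and since p - 1 \<le> 0 the power p - 1 there is
  at least its value at a + 1. The case p \<ge> 0 serves partial sums, the case p < 0 serves
  tails.\<close>

lemma powr_diff_ge:
  fixes a p :: real
  assumes "0 < a" "p \<le> 1"
  shows "p \<ge> 0 \<Longrightarrow> p * (a + 1) powr (p - 1) \<le> (a + 1) powr p - a powr p"
    and "p < 0 \<Longrightarrow> - p * (a + 1) powr (p - 1) \<le> a powr p - (a + 1) powr p"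
proof -
  obtain z where z: "a < z" "z < a + 1"
    "(a + 1) powr p - a powr p = (a + 1 - a) * (p * z powr (p - 1))"
    using powr_mvt[of a "a + 1" p] assms by auto
  have le: "(a + 1) powr (p - 1) \<le> z powr (p - 1)"
    using z(1,2) assms by (intro powr_mono2') auto
  show "p * (a + 1) powr (p - 1) \<le> (a + 1) powr p - a powr p" if "p \<ge> 0"
    using mult_left_mono[OF le that] z(3) by simp
  show "- p * (a + 1) powr (p - 1) \<le> a powr p - (a + 1) powr p" if "p < 0"
    using mult_left_mono_neg[OF le less_imp_le[OF that]] z(3) by simp
qed

lemma sum_powr_le:
  fixes t :: real
  assumes "0 < t" "t \<le> 1"
  shows "t * (\<Sum>n = 1..N. real n powr (t - 1)) \<le> real N powr t"
proof (induction N)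
  case (Suc N)
  show ?case
  \<comment> \<open>The difference bound needs a positive left endpoint; for N = 0 the claim is just
    t \<le> 1.\<close>
  proof (cases "N = 0")
    case False
    then have "t * real (Suc N) powr (t - 1) \<le> real (Suc N) powr t - real N powr t"
      using powr_diff_ge(1)[of "real N" t] assms by (simp add: add.commute)
    with Suc.IH show ?thesis by (simp add: distrib_left)
  qed (use assms in simp)
qed simp

text \<open>Taking p = -t at a = n + 1 bounds each term by (h n - h (n + 1)) / t with h n = (n +
  1)^(-t). As h tends to 0, these differences telescope from K on to h K / t.\<close>

lemma powr_tail_series:
  fixes t :: real
  assumes "0 < t"
  shows "summable (\<lambda>n. (real n + 2) powr (- t - 1))"
    and "(\<Sum>n. (real (n + K) + 2) powr (- t - 1)) \<le> (real K + 1) powr (- t) / t"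
proof -
  define h where "h n = (real n + 1) powr (- t)" for n
  have h0: "h \<longlonglongrightarrow> 0"
  proof -
    have "filterlim (\<lambda>n. real n + 1) at_top sequentially"
      by (rule filterlim_at_top_mono[OF filterlim_real_sequentially]) simp
    then show ?thesis
      unfolding h_def using assms by (intro tendsto_neg_powr) auto
  qed
  have sums: "(\<lambda>n. (h (n + k) - h (Suc n + k)) / t) sums (h k / t)" for k
    using sums_divide[OF telescope_sums'[OF LIMSEQ_ignore_initial_segment[OF h0, of k]], of t]
    by simp
  have le: "(real n + 2) powr (- t - 1) \<le> (h n - h (Suc n)) / t" for n
    using powr_diff_ge(2)[of "real n + 1" "- t"] assms
    by (simp add: h_def field_simps)
  have le': "(real (n + k) + 2) powr (- t - 1) \<le> (h (n + k) - h (Suc n + k)) / t" for n k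
    using le[of "n + k"] by simp
  show summ: "summable (\<lambda>n. (real n + 2) powr (- t - 1))"
    by (rule summable_comparison_test'[OF sums_summable[OF sums[of 0]], of 0])
       (use le in auto)
  have "(\<Sum>n. (real (n + K) + 2) powr (- t - 1)) \<le> (\<Sum>n. (h (n + K) - h (Suc n + K)) / t)"
    by (intro suminf_le le' sums_summable[OF sums] summable_ignore_initial_segment[OF summ])
  also have "\<dots> = h K / t"
    using sums by (rule sums_unique[symmetric])
  finally show "(\<Sum>n. (real (n + K) + 2) powr (- t - 1)) \<le> (real K + 1) powr (- t) / t"
    by (simp add: h_def)
qed

section \<open>Counting the n with a prescribed integer quotient\<close>

lemma nat_floor_div_eq_iff:
  fixes x :: real
  assumes "x > 0" "n > 0" "d > 0"
  shows "nat \<lfloor>x / real n\<rfloor> = d \<longleftrightarrow>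
    nat \<lfloor>x / real (Suc d)\<rfloor> < n \<and> n \<le> nat \<lfloor>x / real d\<rfloor>"
proof -
  have "nat \<lfloor>x / real n\<rfloor> = d \<longleftrightarrow> \<lfloor>x / real n\<rfloor> = int d"
    using assms by auto
  also have "\<dots> \<longleftrightarrow> real d * real n \<le> x \<and> x < (real d + 1) * real n"
    using assms by (simp add: floor_eq_iff field_simps)
  also have "\<dots> \<longleftrightarrow> real n \<le> x / real d \<and> x / real (Suc d) < real n"
    using assms by (simp add: field_simps)
  also have "\<dots> \<longleftrightarrow> n \<le> nat \<lfloor>x / real d\<rfloor> \<and> nat \<lfloor>x / real (Suc d)\<rfloor> < n"
    using assms by (auto simp: le_nat_iff le_floor_iff nat_less_iff floor_less_iff)
  finally show ?thesis by blast
qed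

text \<open>The n in question fill the interval from x/(d+1), excluded, to x/d, included, so their
  number is a difference of two floors. Both rounding errors lie in [0,1), hence differ by less than
  1.\<close>

lemma card_floor_div_eq:
  fixes x :: real
  assumes "x > 0" "d > 0"
  shows "\<bar>real (card {n \<in> {1..nat \<lfloor>x\<rfloor>}. nat \<lfloor>x / real n\<rfloor> = d}) - x / real (d * (d + 1))\<bar> \<le> 1"
proof -
  \<comment> \<open>Ensures that the range 1..x of n cuts nothing off this interval.\<close>
  have sub: "nat \<lfloor>x / real d\<rfloor> \<le> nat \<lfloor>x\<rfloor>"
  proof -
    have "x / real d \<le> x" using assms by (simp add: field_simps)
    then show ?thesis by (intro nat_mono floor_mono)
  qed
  have eq: "{n \<in> {1..nat \<lfloor>x\<rfloor>}. nat \<lfloor>x / real n\<rfloor> = d} =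
      {nat \<lfloor>x / real (Suc d)\<rfloor><..nat \<lfloor>x / real d\<rfloor>}"
  proof (rule set_eqI)
    fix n
    show "n \<in> {n \<in> {1..nat \<lfloor>x\<rfloor>}. nat \<lfloor>x / real n\<rfloor> = d} \<longleftrightarrow>
        n \<in> {nat \<lfloor>x / real (Suc d)\<rfloor><..nat \<lfloor>x / real d\<rfloor>}"
    proof (cases "n = 0")
      case False
      then show ?thesis
        using sub nat_floor_div_eq_iff[of x n d] assms by auto
    qed simp
  qed
  have "x / real (Suc d) \<le> x / real d"
    using assms by (intro divide_left_mono) auto
  then have "nat \<lfloor>x / real (Suc d)\<rfloor> \<le> nat \<lfloor>x / real d\<rfloor>"
    by (intro nat_mono floor_mono)
  then have "real (card {n \<in> {1..nat \<lfloor>x\<rfloor>}. nat \<lfloor>x / real n\<rfloor> = d}) =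
      real (nat \<lfloor>x / real d\<rfloor>) - real (nat \<lfloor>x / real (Suc d)\<rfloor>)"
    unfolding eq by (simp add: of_nat_diff)
  also have "\<dots> = of_int \<lfloor>x / real d\<rfloor> - of_int \<lfloor>x / real (Suc d)\<rfloor>"
    using assms by simp
  finally have "\<bar>real (card {n \<in> {1..nat \<lfloor>x\<rfloor>}. nat \<lfloor>x / real n\<rfloor> = d}) -
      (x / real d - x / real (Suc d))\<bar> \<le> 1"
    by linarith
  also have "x / real d - x / real (Suc d) = x / real (d * (d + 1))"
    using assms by (simp add: field_simps)
  finally show ?thesis .
qed

section \<open>Pointwise and first-moment bounds from the mean square\<close>

locale mean_square_bound =
  fixes f :: "nat \<Rightarrow> complex" and \<alpha> B :: real
  assumes \<alpha>: "0 < \<alpha>" "\<alpha> < 2"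
    and B: "B \<ge> 0"
    and mean_square: "\<And>x. x \<ge> 1 \<Longrightarrow> (\<Sum>n = 1..nat \<lfloor>x\<rfloor>. (cmod (f n))\<^sup>2) \<le> B\<^sup>2 * x powr \<alpha>"
begin

text \<open>The decay exponent left after the pointwise bound: d^(\<alpha>/2) / d^2 = d^(-t-1). It
  is positive exactly because \<alpha> < 2.\<close>

definition t :: real where "t = 1 - \<alpha> / 2"

lemma t: "0 < t" "t < 1"
  using \<alpha> by (auto simp: t_def)

text \<open>A single square is at most the whole sum of squares up to d.\<close>

lemma norm_le: "cmod (f d) \<le> B * real d powr (\<alpha> / 2)" if "d > 0"
proof -
  have "(cmod (f d))\<^sup>2 \<le> (\<Sum>n = 1..d. (cmod (f n))\<^sup>2)"
    using that by (intro member_le_sum) auto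
  also have "\<dots> \<le> B\<^sup>2 * real d powr \<alpha>"
    using mean_square[of "real d"] that by simp
  also have "\<dots> = (B * real d powr (\<alpha> / 2))\<^sup>2"
    by (simp add: power_mult_distrib power2_eq_square flip: powr_add)
  finally show ?thesis
    by (rule power2_le_imp_le) (use B in auto)
qed

text \<open>Cauchy--Schwarz against the constant 1: the at most y terms contribute a factor y next
  to the mean square.\<close>

lemma sum_cmod_le:
  assumes "y \<ge> 1"
  shows "(\<Sum>d = 1..nat \<lfloor>y\<rfloor>. cmod (f d)) \<le> B * y powr ((\<alpha> + 1) / 2)"
proof (rule power2_le_imp_le)
  let ?I = "{1..nat \<lfloor>y\<rfloor>}"
  have "(\<Sum>d\<in>?I. cmod (f d)) \<le> L2_set (\<lambda>_. 1) ?I * L2_set (\<lambda>d. cmod (f d)) ?I"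
    using L2_set_mult_ineq[of "\<lambda>_. 1" "\<lambda>d. cmod (f d)" ?I] by simp
  then have "(\<Sum>d\<in>?I. cmod (f d))\<^sup>2 \<le> (L2_set (\<lambda>_. 1) ?I * L2_set (\<lambda>d. cmod (f d)) ?I)\<^sup>2"
    by (intro power_mono sum_nonneg) auto
  also have "\<dots> = real (nat \<lfloor>y\<rfloor>) * (\<Sum>d\<in>?I. (cmod (f d))\<^sup>2)"
    by (simp add: L2_set_def power_mult_distrib sum_nonneg)
  also have "\<dots> \<le> y * (B\<^sup>2 * y powr \<alpha>)"
    using assms mean_square by (intro mult_mono sum_nonneg) auto
  also have "\<dots> = B\<^sup>2 * y powr (\<alpha> + 1)"
    using assms by (simp add: powr_add)
  also have "\<dots> = (B * y powr ((\<alpha> + 1) / 2))\<^sup>2"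
    by (simp add: power_mult_distrib power2_eq_square flip: powr_add)
  finally show "(\<Sum>d = 1..nat \<lfloor>y\<rfloor>. cmod (f d))\<^sup>2 \<le> (B * y powr ((\<alpha> + 1) / 2))\<^sup>2" .
qed (use B in auto)

section \<open>The series of the main term and its tail\<close>

definition summand :: "nat \<Rightarrow> complex" where
  "summand n = f (Suc n) / of_nat (Suc n * (Suc n + 1))"

lemma norm_summand_le: "cmod (summand n) \<le> 2 * B * (real n + 2) powr (- t - 1)"
proof -
  have "cmod (summand n) = cmod (f (Suc n)) / real (Suc n * (Suc n + 1))"
    by (simp only: summand_def norm_divide norm_of_nat)
  also have "\<dots> = cmod (f (Suc n)) / ((real n + 1) * (real n + 2))"
    by (simp add: algebra_simps)
  \<comment> \<open>The later factor 2 comes from n + 1 \<ge> (n + 2)/2, which expresses everything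
    through n + 2.\<close>
  also have "\<dots> \<le> (B * (real n + 2) powr (\<alpha> / 2)) / ((real n + 2) / 2 * (real n + 2))"
  proof (rule frac_le)
    have "cmod (f (Suc n)) \<le> B * real (Suc n) powr (\<alpha> / 2)"
      by (rule norm_le) simp
    also have "\<dots> \<le> B * (real n + 2) powr (\<alpha> / 2)"
      using B \<alpha> by (intro mult_left_mono powr_mono2) auto
    finally show "cmod (f (Suc n)) \<le> B * (real n + 2) powr (\<alpha> / 2)" .
  qed (use B in \<open>auto intro!: mult_right_mono\<close>)
  also have "\<dots> = 2 * B * ((real n + 2) powr (\<alpha> / 2) / (real n + 2) powr 2)"
    by (simp add: power2_eq_square)
  also have "\<dots> = 2 * B * (real n + 2) powr (- t - 1)"
    unfolding powr_diff[symmetric] by (simp add: t_def)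
  finally show ?thesis .
qed

lemma summable_summand: "summable summand"
  by (rule summable_comparison_test'[OF summable_mult[OF powr_tail_series(1)[OF t(1)]], of 0])
     (rule norm_summand_le)

lemma norm_tail_le: "cmod (\<Sum>n. summand (n + K)) \<le> 2 * B * ((real K + 1) powr (- t) / t)"
proof -
  note summ = summable_ignore_initial_segment[OF powr_tail_series(1)[OF t(1)], of K]
  have le: "cmod (summand (n + K)) \<le> 2 * B * (real (n + K) + 2) powr (- t - 1)" for n
    by (rule norm_summand_le)
  have sn: "summable (\<lambda>n. cmod (summand (n + K)))"
    by (rule summable_comparison_test'[OF summable_mult[OF summ], of 0 _ "2 * B"])
       (use le in auto)
  have "cmod (\<Sum>n. summand (n + K)) \<le> (\<Sum>n. cmod (summand (n + K)))"
    by (rule summable_norm[OF sn])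
  also have "\<dots> \<le> (\<Sum>n. 2 * B * (real (n + K) + 2) powr (- t - 1))"
    by (intro suminf_le le sn summable_mult summ)
  also have "\<dots> = 2 * B * (\<Sum>n. (real (n + K) + 2) powr (- t - 1))"
    by (rule suminf_mult[OF summ])
  also have "\<dots> \<le> 2 * B * ((real K + 1) powr (- t) / t)"
    using B by (intro mult_left_mono powr_tail_series t) auto
  finally show ?thesis .
qed

section \<open>Large quotients, small quotients and the total error\<close>

lemma sum_large_quotients_le:
  assumes "x \<ge> 1" and y: "y > 0"
  shows "(\<Sum>n | n \<in> {1..nat \<lfloor>x\<rfloor>} \<and> y < real (nat \<lfloor>x / real n\<rfloor>). cmod (f (nat \<lfloor>x / real n\<rfloor>)))
    \<le> B / t * x powr (\<alpha> / 2) * (x / y) powr t"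
proof -
  let ?q = "\<lambda>n. nat \<lfloor>x / real n\<rfloor>"
  let ?N = "nat \<lfloor>x / y\<rfloor>"
  have "(\<Sum>n | n \<in> {1..nat \<lfloor>x\<rfloor>} \<and> y < real (?q n). cmod (f (?q n)))
      \<le> (\<Sum>n | n \<in> {1..nat \<lfloor>x\<rfloor>} \<and> y < real (?q n). B * x powr (\<alpha> / 2) * real n powr (t - 1))"
  proof (rule sum_mono)
    fix n assume "n \<in> {n. n \<in> {1..nat \<lfloor>x\<rfloor>} \<and> y < real (?q n)}"
    then have n: "n > 0" "y < real (?q n)" by auto
    have "real (?q n) \<le> x / real n"
      using assms by (intro of_nat_floor) simp
    then have "B * real (?q n) powr (\<alpha> / 2) \<le> B * (x / real n) powr (\<alpha> / 2)"
      using B \<alpha> by (intro mult_left_mono powr_mono2) auto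
    moreover have "cmod (f (?q n)) \<le> B * real (?q n) powr (\<alpha> / 2)"
      using less_trans[OF y n(2)] unfolding of_nat_0_less_iff by (rule norm_le)
    \<comment> \<open>The exponents agree because \<alpha>/2 = 1 - t.\<close>
    moreover have "(x / real n) powr (\<alpha> / 2) = x powr (\<alpha> / 2) * real n powr (t - 1)"
      using assms n by (simp add: powr_divide t_def powr_minus field_simps)
    ultimately show "cmod (f (?q n)) \<le> B * x powr (\<alpha> / 2) * real n powr (t - 1)"
      by simp
  qed
  \<comment> \<open>A quotient above y forces n < x/y. The terms are nonnegative, so the sum may be
    extended to all n \<le> x/y.\<close>
  also have "\<dots> \<le> (\<Sum>n = 1..?N. B * x powr (\<alpha> / 2) * real n powr (t - 1))"
  proof (rule sum_mono2)
    show "{n. n \<in> {1..nat \<lfloor>x\<rfloor>} \<and> y < real (?q n)} \<subseteq> {1..?N}"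
    proof safe
      fix n assume n: "n \<in> {1..nat \<lfloor>x\<rfloor>}" "y < real (?q n)"
      have "real (?q n) \<le> x / real n"
        using assms by (intro of_nat_floor) simp
      with n have "y < x / real n" by simp
      with n y have "real n \<le> x / y"
        by (simp add: field_simps)
      with n show "n \<in> {1..?N}"
        by (simp add: le_nat_floor)
    qed
  qed (use B in auto)
  also have "\<dots> = B / t * x powr (\<alpha> / 2) * (t * (\<Sum>n = 1..?N. real n powr (t - 1)))"
    using t by (simp add: sum_distrib_left mult.assoc)
  also have "\<dots> \<le> B / t * x powr (\<alpha> / 2) * (x / y) powr t"
  proof (rule mult_left_mono)
    have "t * (\<Sum>n = 1..?N. real n powr (t - 1)) \<le> real ?N powr t"
      using t by (intro sum_powr_le) auto
    also have "\<dots> \<le> (x / y) powr t"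
      using assms y t by (intro powr_mono2) auto
    finally show "t * (\<Sum>n = 1..?N. real n powr (t - 1)) \<le> (x / y) powr t" .
  qed (use B t in auto)
  finally show ?thesis .
qed

text \<open>Grouped by the quotient d, f d has a multiplicity within 1 of x/(d(d+1)). These main
  values rebuild x times the partial series, and the errors cost at most the sum of |f d| over d
  \<le> y.\<close>

lemma norm_small_quotients_le:
  assumes "x \<ge> 1" "y \<ge> 1"
  shows "cmod ((\<Sum>n | n \<in> {1..nat \<lfloor>x\<rfloor>} \<and> nat \<lfloor>x / real n\<rfloor> \<le> nat \<lfloor>y\<rfloor>. f (nat \<lfloor>x / real n\<rfloor>))
    - of_real x * (\<Sum>n<nat \<lfloor>y\<rfloor>. summand n)) \<le> B * y powr ((\<alpha> + 1) / 2)"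
proof -
  let ?q = "\<lambda>n. nat \<lfloor>x / real n\<rfloor>"
  let ?K = "nat \<lfloor>y\<rfloor>"
  let ?A = "{n. n \<in> {1..nat \<lfloor>x\<rfloor>} \<and> ?q n \<le> ?K}"
  let ?c = "\<lambda>d. card {n \<in> {1..nat \<lfloor>x\<rfloor>}. ?q n = d}"
  \<comment> \<open>No n \<le> x has quotient 0, so the groups d = 1..K exhaust the sum and f 0
    never occurs.\<close>
  have pos: "?q n \<ge> 1" if "n \<in> {1..nat \<lfloor>x\<rfloor>}" for n
  proof -
    have "real n \<le> x" using that assms by (auto simp: le_nat_iff le_floor_iff)
    then have "1 \<le> x / real n" using that by (simp add: field_simps)
    then show ?thesis by (simp add: le_nat_iff le_floor_iff)
  qed
  have "(\<Sum>n\<in>?A. f (?q n)) = (\<Sum>d = 1..?K. \<Sum>n | n \<in> ?A \<and> ?q n = d. f (?q n))"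
    by (rule sum.group[symmetric]) (use pos in auto)
  also have "\<dots> = (\<Sum>d = 1..?K. of_nat (?c d) * f d)"
  proof (rule sum.cong)
    fix d assume "d \<in> {1..?K}"
    then have "{n. n \<in> ?A \<and> ?q n = d} = {n \<in> {1..nat \<lfloor>x\<rfloor>}. ?q n = d}" by auto
    then show "(\<Sum>n | n \<in> ?A \<and> ?q n = d. f (?q n)) = of_nat (?c d) * f d"
      by simp
  qed simp
  finally have 1: "(\<Sum>n\<in>?A. f (?q n)) = (\<Sum>d = 1..?K. of_nat (?c d) * f d)" .
  have 2: "of_real x * (\<Sum>n<?K. summand n) = (\<Sum>d = 1..?K. of_real (x / real (d * (d + 1))) * f d)"
  proof -
    have "(\<Sum>d = 1..?K. of_real (x / real (d * (d + 1))) * f d) =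
        (\<Sum>n<?K. of_real (x / real (Suc n * (Suc n + 1))) * f (Suc n))"
      unfolding One_nat_def by (rule sum.atLeast1_atMost_eq)
    also have "\<dots> = (\<Sum>n<?K. of_real x * summand n)"
      by (rule sum.cong) (simp_all only: summand_def of_real_divide of_real_of_nat_eq times_divide_eq_left times_divide_eq_right)
    finally show ?thesis by (simp add: sum_distrib_left)
  qed
  have "cmod ((\<Sum>n\<in>?A. f (?q n)) - of_real x * (\<Sum>n<?K. summand n)) =
      cmod (\<Sum>d = 1..?K. of_real (real (?c d) - x / real (d * (d + 1))) * f d)"
    unfolding 1 2 by (simp only: sum_subtractf[symmetric] left_diff_distrib of_real_diff of_real_of_nat_eq)
  also have "\<dots> \<le> (\<Sum>d = 1..?K. cmod (f d))"
  proof (rule sum_norm_le)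
    fix d assume "d \<in> {1..?K}"
    then have "\<bar>real (?c d) - x / real (d * (d + 1))\<bar> \<le> 1"
      using assms by (intro card_floor_div_eq) auto
    then show "cmod (of_real (real (?c d) - x / real (d * (d + 1))) * f d) \<le> cmod (f d)"
      unfolding norm_mult norm_of_real by (intro mult_left_le_one_le) auto
  qed
  also have "\<dots> \<le> B * y powr ((\<alpha> + 1) / 2)"
    by (rule sum_cmod_le[OF assms(2)])
  finally show ?thesis .
qed

lemma norm_error_le:
  assumes "x \<ge> 1"
  shows "cmod ((\<Sum>n = 1..nat \<lfloor>x\<rfloor>. f (nat \<lfloor>x / real n\<rfloor>)) - of_real x * suminf summand)
    \<le> (B + 3 * B / t) * x powr ((\<alpha> + 1) / 3)"
proof -
  let ?q = "\<lambda>n. nat \<lfloor>x / real n\<rfloor>"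
  \<comment> \<open>This cut balances the errors: small quotients cost y^((\<alpha>+1)/2), large
    ones and the tail cost x y^(-t), since x^(\<alpha>/2) (x/y)^t = x y^(-t). Equality means y^(3/2)
    = x.\<close>
  define y where "y = x powr (2 / 3)"
  have y: "y \<ge> 1" using assms by (simp add: y_def ge_one_powr_ge_zero)
  let ?K = "nat \<lfloor>y\<rfloor>"
  let ?A = "{n. n \<in> {1..nat \<lfloor>x\<rfloor>} \<and> ?q n \<le> ?K}"
  let ?L = "{n. n \<in> {1..nat \<lfloor>x\<rfloor>} \<and> y < real (?q n)}"
  \<comment> \<open>Quotients are integers, so comparing them with y or with its floor is the same;
    hence \<open>?A\<close> and \<open>?L\<close> are complementary.\<close>
  have yiff: "y < real m \<longleftrightarrow> \<not> m \<le> ?K" for m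
    using y by (auto simp: le_nat_iff le_floor_iff)
  have split: "(\<Sum>n = 1..nat \<lfloor>x\<rfloor>. f (?q n)) = (\<Sum>n\<in>?A. f (?q n)) + (\<Sum>n\<in>?L. f (?q n))"
    unfolding yiff by (subst sum.union_disjoint[symmetric]) (auto intro!: sum.cong)
  have ser: "suminf summand = (\<Sum>n. summand (n + ?K)) + (\<Sum>n<?K. summand n)"
    by (rule suminf_split_initial_segment[OF summable_summand])
  have eq: "(\<Sum>n = 1..nat \<lfloor>x\<rfloor>. f (?q n)) - of_real x * suminf summand =
      ((\<Sum>n\<in>?A. f (?q n)) - of_real x * (\<Sum>n<?K. summand n)) +
      (\<Sum>n\<in>?L. f (?q n)) - of_real x * (\<Sum>n. summand (n + ?K))"
    unfolding split ser by (simp add: algebra_simps)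
  have a: "cmod ((\<Sum>n\<in>?A. f (?q n)) - of_real x * (\<Sum>n<?K. summand n)) \<le> B * x powr ((\<alpha> + 1) / 3)"
  proof -
    have "y powr ((\<alpha> + 1) / 2) = x powr ((\<alpha> + 1) / 3)"
      unfolding y_def powr_powr by (rule arg_cong[where f = "(powr) x"]) (simp add: field_simps)
    with norm_small_quotients_le[OF assms y] show ?thesis by metis
  qed
  have b: "cmod (\<Sum>n\<in>?L. f (?q n)) \<le> B / t * x powr ((\<alpha> + 1) / 3)"
  proof -
    have "x / y = x powr (1 / 3)"
      using assms powr_diff[of x 1 "2 / 3"] by (simp add: y_def)
    then have "x powr (\<alpha> / 2) * (x / y) powr t = x powr (\<alpha> / 2 + 1 / 3 * t)"
      by (simp add: powr_powr powr_add)
    also have "\<alpha> / 2 + 1 / 3 * t = (\<alpha> + 1) / 3"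
      by (simp add: t_def field_simps)
    finally have "x powr (\<alpha> / 2) * (x / y) powr t = x powr ((\<alpha> + 1) / 3)" .
    moreover have "cmod (\<Sum>n\<in>?L. f (?q n)) \<le> (\<Sum>n\<in>?L. cmod (f (?q n)))"
      by (rule norm_sum)
    ultimately show ?thesis
      using sum_large_quotients_le[OF assms, of y] y by (simp add: mult.assoc)
  qed
  have c: "cmod (of_real x * (\<Sum>n. summand (n + ?K))) \<le> 2 * B / t * x powr ((\<alpha> + 1) / 3)"
  proof -
    \<comment> \<open>Uses \<open>?K\<close> + 1 > y and the negative exponent.\<close>
    have "(real ?K + 1) powr (- t) \<le> y powr (- t)"
      using y t by (intro powr_mono2') linarith+
    then have "2 * B * ((real ?K + 1) powr (- t) / t) \<le> 2 * B * (y powr (- t) / t)"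
      using B t by (intro mult_left_mono divide_right_mono) auto
    with norm_tail_le[of ?K]
    have "cmod (\<Sum>n. summand (n + ?K)) \<le> 2 * B * (y powr (- t) / t)"
      by linarith
    then have "cmod (of_real x * (\<Sum>n. summand (n + ?K))) \<le> x * (2 * B * (y powr (- t) / t))"
      using assms unfolding norm_mult by (intro mult_mono) auto
    also have "\<dots> = 2 * B / t * (x powr 1 * y powr (- t))"
      using assms by simp
    also have "x powr 1 * y powr (- t) = x powr ((\<alpha> + 1) / 3)"
      unfolding y_def powr_powr powr_add[symmetric]
      by (rule arg_cong[where f = "(powr) x"]) (simp add: t_def field_simps)
    finally show ?thesis .
  qed
  have "cmod ((\<Sum>n = 1..nat \<lfloor>x\<rfloor>. f (?q n)) - of_real x * suminf summand) \<le>
      B * x powr ((\<alpha> + 1) / 3) + B / t * x powr ((\<alpha> + 1) / 3) + 2 * B / t * x powr ((\<alpha> + 1) / 3)"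
    unfolding eq by (intro norm_triangle_le_diff add_mono norm_triangle_le a b c)
  also have "\<dots> = (B + 3 * B / t) * x powr ((\<alpha> + 1) / 3)"
    by (simp add: algebra_simps add_divide_distrib)
  finally show ?thesis .
qed

end

section \<open>Passing to the asymptotic statement\<close>

lemma eventually_eps2_nonneg: "eventually (\<lambda>x. eps2 x \<ge> 0) at_top"
proof -
  have "filterlim (\<lambda>x::real. ln (ln (ln x))) at_top at_top"
    by (intro filterlim_compose[OF ln_at_top] ln_at_top)
  then have "eventually (\<lambda>x::real. ln (ln (ln x)) \<ge> 0) at_top"
    by (simp add: filterlim_at_top)
  moreover have "filterlim (\<lambda>x::real. ln (ln x)) at_top at_top"
    by (intro filterlim_compose[OF ln_at_top] ln_at_top)
  then have "eventually (\<lambda>x::real. ln (ln x) \<ge> 0) at_top"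
    by (simp add: filterlim_at_top)
  ultimately show ?thesis
    \<comment> \<open>Nonstrict inequalities suffice: a vanishing denominator makes the quotient 0
      by convention.\<close>
    by eventually_elim (auto simp: eps2_def)
qed

theorem theorem2p6:
  fixes f :: "nat \<Rightarrow> complex" and \<alpha> :: real
  assumes "0 < \<alpha>" and "\<alpha> < 2"
    and "\<exists>C. \<forall>x::real. x \<ge> 1 \<longrightarrow> (\<Sum>n = 1..nat \<lfloor>x\<rfloor>. (cmod (f n))\<^sup>2) \<le> C * x powr \<alpha>"
  shows "summable (\<lambda>n. f (Suc n) / of_nat (Suc n * (Suc n + 1))) \<and>
         (\<lambda>x::real. cmod ((\<Sum>n = 1..nat \<lfloor>x\<rfloor>. f (nat \<lfloor>x / real n\<rfloor>))
              - of_real x * (\<Sum>n. f (Suc n) / of_nat (Suc n * (Suc n + 1)))))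
          \<in> O[at_top](\<lambda>x. x powr ((\<alpha> + 1) / 3) * ln x powr ((1 + \<alpha>) * (2 + eps2 x) / 6))"
proof -
  obtain C where C: "\<And>x::real. x \<ge> 1 \<Longrightarrow> (\<Sum>n = 1..nat \<lfloor>x\<rfloor>. (cmod (f n))\<^sup>2) \<le> C * x powr \<alpha>"
    using assms(3) by blast
  \<comment> \<open>At x = 1 the hypothesis bounds a nonnegative sum by C.\<close>
  have "C \<ge> 0"
    using order_trans[OF _ C[of 1], of 0] by (simp add: sum_nonneg)
  \<comment> \<open>The locale states its constant as a square so that the derived bounds are linear
    in \<open>B\<close>; thus \<open>B\<close> is \<open>sqrt C\<close>.\<close>
  interpret mean_square_bound f \<alpha> "sqrt C"
    by unfold_locales (use assms C \<open>C \<ge> 0\<close> in auto)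
  let ?B = "sqrt C + 3 * sqrt C / t"
  have B: "?B \<ge> 0" using \<open>C \<ge> 0\<close> t by simp
  have "eventually (\<lambda>x::real. ln x \<ge> 1) at_top"
    using ln_at_top by (simp add: filterlim_at_top)
  with eventually_eps2_nonneg eventually_ge_at_top[of "1::real"]
  have "eventually (\<lambda>x::real. norm (cmod ((\<Sum>n = 1..nat \<lfloor>x\<rfloor>. f (nat \<lfloor>x / real n\<rfloor>)) - of_real x * suminf summand))
      \<le> ?B * norm (x powr ((\<alpha> + 1) / 3) * ln x powr ((1 + \<alpha>) * (2 + eps2 x) / 6))) at_top"
  proof eventually_elim
    case (elim x)
    \<comment> \<open>The base ln x is at least 1 and the exponent is nonnegative once
      \<open>eps2 x\<close> is, so the logarithmic factor only enlarges the bound.\<close>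
    have "1 \<le> ln x powr ((1 + \<alpha>) * (2 + eps2 x) / 6)"
      using elim assms by (intro ge_one_powr_ge_zero) auto
    then have "x powr ((\<alpha> + 1) / 3) \<le>
        x powr ((\<alpha> + 1) / 3) * ln x powr ((1 + \<alpha>) * (2 + eps2 x) / 6)"
      by (simp add: mult_le_cancel_left1)
    from order_trans[OF norm_error_le[OF elim(2)] mult_left_mono[OF this B]]
    show ?case by simp
  qed
  then have "(\<lambda>x::real. cmod ((\<Sum>n = 1..nat \<lfloor>x\<rfloor>. f (nat \<lfloor>x / real n\<rfloor>)) - of_real x * suminf summand))
      \<in> O[at_top](\<lambda>x. x powr ((\<alpha> + 1) / 3) * ln x powr ((1 + \<alpha>) * (2 + eps2 x) / 6))"
    by (rule bigoI)
  with summable_summand show ?thesis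
    unfolding summand_def by blast
qed

end
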